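(* Let $\mathcal{H}$ be an infinite-dimensional Hilbert space and let $\mathcal{O}_\infty\subset B(\mathcal{H})$ be a unital inclusion, given by an infinite Cuntz family of isometries $\{v_i\}_{i=1}^\infty$ in $B(\mathcal{H})$. Then $\{v_i\}_{i=1}^\infty$ separates the points of $B(\mathcal{H})$ if and only if the inclusion map, viewed as a representation of $\mathcal{O}_\infty$ on $\mathcal{H}$, is essential.
   Context: An (infinite) Cuntz family of isometries in a unital C*-algebra $A$ is a sequence $\{v_i\}_{i=1}^{\infty}$ of isometries in $A$ such that $\sum_{i=1}^n v_iv_i^*\le 1_A$ for all $1\le n<\infty$; it generates a unital copy of the Cuntz algebra $\mathcal{O}_\infty$. With $p_i:=v_iv_i^*$, the family separates the points of $A$ if the only $x\in A$ such that $p_i x p_j=0$ for all $i$ and $j$ is $x=0$. A representation of $\mathcal{O}_\infty$ on $\mathcal{H}$ is called essential if the projections $v_iv_i^*$ (where $v_i$ are the images of the generators) sum sequentially and strongly to $1$, i.e. $\sum_{i=1}^\infty v_iv_i^*=1$ in the strong operator topology. *)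

theory Defs
  imports "HOL-Analysis.Analysis"
begin

section \<open>Complex Hilbert spaces\<close>

text \<open>
  A complex Hilbert space is given together with its underlying real Hilbert space, whose inner
  product is the real part of the complex one; in particular the norm is
  \<open>sqrt (Re (cinner x x))\<close>. The complex inner product is linear in its first argument.
\<close>

class complex_hilbert_space = real_inner + banach +
  fixes scaleC :: "complex \<Rightarrow> 'a \<Rightarrow> 'a"  (infixr \<open>*\<^sub>C\<close> 75)
    and cinner :: "'a \<Rightarrow> 'a \<Rightarrow> complex"
  assumes scaleC_add_right: "c *\<^sub>C (x + y) = c *\<^sub>C x + c *\<^sub>C y"
    and scaleC_add_left: "(c + d) *\<^sub>C x = c *\<^sub>C x + d *\<^sub>C x"
    and scaleC_scaleC: "c *\<^sub>C (d *\<^sub>C x) = (c * d) *\<^sub>C x"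
    and scaleC_of_real: "complex_of_real r *\<^sub>C x = r *\<^sub>R x"
    and cinner_commute: "cinner x y = cnj (cinner y x)"
    and cinner_add_left: "cinner (x + y) z = cinner x z + cinner y z"
    and cinner_scaleC_left: "cinner (c *\<^sub>C x) y = c * cinner x y"
    and Re_cinner: "Re (cinner x y) = inner x y"

global_interpretation complex_space:
  vector_space "scaleC :: complex \<Rightarrow> 'a \<Rightarrow> 'a::complex_hilbert_space"
proof
  fix x :: 'a
  show "1 *\<^sub>C x = x"
    using scaleC_of_real[of 1 x] by simp
qed (simp_all add: scaleC_add_right scaleC_add_left scaleC_scaleC)

definition infinite_dimensional :: "'a::complex_hilbert_space itself \<Rightarrow> bool" where
  "infinite_dimensional _ \<longleftrightarrow> \<not> (\<exists>B::'a set. finite B \<and> complex_space.span B = UNIV)"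

section \<open>Bounded operators and adjoints\<close>

text \<open>
  The type \<open>'a \<Rightarrow>\<^sub>L 'a\<close> consists of the bounded \<^emph>\<open>real\<close>-linear operators;
  \<open>B(H)\<close> is the subset of the complex-linear ones, with the inherited norm and algebra structure
  (the product being \<open>(o\<^sub>L)\<close>).
\<close>

definition bounded_operators :: "('a::complex_hilbert_space \<Rightarrow>\<^sub>L 'a) set" where
  "bounded_operators = {T. \<forall>c x. blinfun_apply T (c *\<^sub>C x) = c *\<^sub>C blinfun_apply T x}"

definition scale_operator ::
  "complex \<Rightarrow> ('a::complex_hilbert_space \<Rightarrow>\<^sub>L 'a) \<Rightarrow> ('a \<Rightarrow>\<^sub>L 'a)" where
  "scale_operator c T = Blinfun (\<lambda>x. c *\<^sub>C blinfun_apply T x)"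

definition adjoint_operator ::
  "('a::complex_hilbert_space \<Rightarrow>\<^sub>L 'a) \<Rightarrow> ('a \<Rightarrow>\<^sub>L 'a)" where
  "adjoint_operator T =
     (THE S. \<forall>x y. cinner (blinfun_apply T x) y = cinner x (blinfun_apply S y))"

text \<open>Existence and uniqueness of adjoints, via the Riesz representation theorem.\<close>

lemma riesz_representation_real:
  fixes f :: "'a::{real_inner, banach} \<Rightarrow> real"
  assumes "bounded_linear f"
  shows "\<exists>z. \<forall>x. f x = inner x z"
proof -
  interpret f: bounded_linear f by fact
  define J where "J x = (norm x)\<^sup>2 - 2 * f x" for x
  define d where "d = Inf (range J)"
  obtain K where K: "\<And>x. norm (f x) \<le> norm x * K"
    using f.bounded by blast
  have J_ge: "- K\<^sup>2 \<le> J x" for x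
  proof -
    have "0 \<le> (norm x - K)\<^sup>2" by simp
    moreover have "f x \<le> norm x * K" using K[of x] by simp
    ultimately show ?thesis
      unfolding J_def by (simp add: power2_diff)
  qed
  have bdd: "bdd_below (range J)"
    using J_ge by (auto intro!: bdd_belowI[of _ "- K\<^sup>2"])
  have d_le: "d \<le> J x" for x
    unfolding d_def by (rule cInf_lower[OF _ bdd]) simp
  have "\<exists>x. J x < d + inverse (real (Suc n))" for n
  proof -
    have "Inf (range J) < d + inverse (real (Suc n))"
      unfolding d_def by simp
    then show ?thesis
      using bdd by (subst (asm) cInf_less_iff) auto
  qed
  then obtain X where X: "\<And>n. J (X n) < d + inverse (real (Suc n))"
    by metis
  have par: "(norm (x - y))\<^sup>2 \<le> 2 * (J x - d) + 2 * (J y - d)" for x y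
  proof -
    have "(norm (x - y))\<^sup>2 = 2 * J x + 2 * J y - 4 * J ((1/2) *\<^sub>R (x + y))"
      unfolding J_def power2_norm_eq_inner
      by (simp add: inner_simps f.scaleR f.add inner_commute[of y x] field_simps)
    then show ?thesis using d_le[of "(1/2) *\<^sub>R (x + y)"] by simp
  qed
  have "Cauchy X"
  proof (rule metric_CauchyI)
    fix e :: real assume "0 < e"
    then obtain M where M: "inverse (real (Suc M)) < e\<^sup>2 / 4"
      using reals_Archimedean[of "e\<^sup>2 / 4"] by auto
    have "dist (X m) (X n) < e" if "m \<ge> M" "n \<ge> M" for m n
    proof -
      have inv: "inverse (real (Suc k)) < e\<^sup>2 / 4" if "k \<ge> M" for k
        using that M by (intro order.strict_trans1[OF _ M]) (simp add: le_imp_inverse_le)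
      have "J (X k) - d < e\<^sup>2 / 4" if "k \<ge> M" for k
        using order.strict_trans[OF X[of k] add_strict_left_mono[OF inv[OF that]]] by simp
      from this[OF that(1)] this[OF that(2)]
      have "2 * (J (X m) - d) + 2 * (J (X n) - d) < e\<^sup>2" by argo
      then have "(norm (X m - X n))\<^sup>2 < e\<^sup>2"
        using par[of "X m" "X n"] by (rule order.strict_trans1[rotated])
      then show ?thesis
        using \<open>0 < e\<close> power_less_imp_less_base[of "norm (X m - X n)" 2 e]
        by (simp add: dist_norm)
    qed
    then show "\<exists>M. \<forall>m\<ge>M. \<forall>n\<ge>M. dist (X m) (X n) < e" by blast
  qed
  then obtain z where z: "X \<longlonglongrightarrow> z"
    using Cauchy_convergent convergent_def by blast
  have "(\<lambda>n. J (X n)) \<longlonglongrightarrow> J z"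
    unfolding J_def by (intro tendsto_intros z f.tendsto)
  moreover have "(\<lambda>n. d + inverse (real (Suc n))) \<longlonglongrightarrow> d + 0"
    by (intro tendsto_intros LIMSEQ_inverse_real_of_nat)
  ultimately have "J z \<le> d"
    using LIMSEQ_le[of "\<lambda>n. J (X n)" "J z" "\<lambda>n. d + inverse (real (Suc n))" "d + 0"] X
    by (auto intro: less_imp_le)
  have "f x = inner x z" for x
  proof -
    define a where "a = inner x z - f x"
    have ineq: "0 \<le> 2 * t * a + t\<^sup>2 * (norm x)\<^sup>2" for t
    proof -
      have "J z \<le> J (z + t *\<^sub>R x)"
        using \<open>J z \<le> d\<close> d_le order_trans by blast
      moreover have "J (z + t *\<^sub>R x) = J z + 2 * t * a + t\<^sup>2 * (norm x)\<^sup>2"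
        unfolding J_def a_def power2_norm_eq_inner
        by (simp add: inner_simps f.scaleR f.add inner_commute[of z x]
            power2_eq_square algebra_simps)
      ultimately show ?thesis by simp
    qed
    define N where "N = (norm x)\<^sup>2 + 1"
    have N: "N > 0" "(norm x)\<^sup>2 < N" unfolding N_def by (simp_all add: add_nonneg_pos)
    have "0 \<le> 2 * (- a / N) * a + (- a / N)\<^sup>2 * (norm x)\<^sup>2" by (rule ineq)
    also have "\<dots> \<le> 2 * (- a / N) * a + (- a / N)\<^sup>2 * N"
      using N by (intro add_left_mono mult_left_mono) auto
    also have "\<dots> = - (a\<^sup>2 / N)"
      using N by (simp add: power2_eq_square field_simps)
    finally have "a\<^sup>2 \<le> 0" using N by (simp add: divide_le_0_iff zero_le_divide_iff)
    then show ?thesis unfolding a_def by simp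
  qed
  then show ?thesis by blast
qed

lemma inner_right_eqI:
  fixes x y :: "'a::real_inner"
  assumes "\<And>z. inner z x = inner z y"
  shows "x = y"
proof -
  have "inner (x - y) (x - y) = 0"
    using assms[of "x - y"] by (simp add: inner_diff_right)
  then show ?thesis by simp
qed

lemma cinner_eqI:
  fixes x y :: "'a::complex_hilbert_space"
  assumes "\<And>z. cinner z x = cinner z y"
  shows "x = y"
proof (rule inner_right_eqI)
  show "inner z x = inner z y" for z
    using assms[of z] by (simp flip: Re_cinner)
qed

lemma adjoint_operator_ex1:
  fixes T :: "'a::complex_hilbert_space \<Rightarrow>\<^sub>L 'a"
  assumes T: "T \<in> bounded_operators"
  shows "\<exists>!S. \<forall>x y. cinner (blinfun_apply T x) y = cinner x (blinfun_apply S y)"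
proof -
  have "\<exists>z. \<forall>x. inner (blinfun_apply T x) y = inner x z" for y
    by (rule riesz_representation_real)
       (intro bounded_linear_intros)
  then obtain S where S: "\<And>x y. inner (blinfun_apply T x) y = inner x (S y)"
    by metis
  have "bounded_linear S"
  proof (rule bounded_linear_intro[where K = "norm T"])
    fix x y :: 'a and r :: real
    have "inner z (S (x + y)) = inner z (S x + S y)" for z
      by (simp add: inner_add_right flip: S)
    then show "S (x + y) = S x + S y" by (rule inner_right_eqI)
    have "inner z (S (r *\<^sub>R x)) = inner z (r *\<^sub>R S x)" for z
      by (simp flip: S)
    then show "S (r *\<^sub>R x) = r *\<^sub>R S x" by (rule inner_right_eqI)
    have "norm (S x) * norm (S x) = inner (blinfun_apply T (S x)) x"
      by (simp add: S flip: power2_eq_square power2_norm_eq_inner)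
    also have "\<dots> \<le> norm (blinfun_apply T (S x)) * norm x"
      by (rule norm_cauchy_schwarz)
    also have "\<dots> \<le> (norm T * norm (S x)) * norm x"
      by (intro mult_right_mono norm_blinfun) simp
    finally have "norm (S x) * norm (S x) \<le> norm (S x) * (norm x * norm T)"
      by (simp add: mult_ac)
    then show "norm (S x) \<le> norm x * norm T"
      by (cases "S x = 0") simp_all
  qed
  then have app: "blinfun_apply (Blinfun S) = S"
    by (rule bounded_linear_Blinfun_apply)
  have Im: "Im (cinner x y) = - Re (cinner (\<i> *\<^sub>C x) y)" for x y :: 'a
    by (simp add: cinner_scaleC_left)
  have "cinner (blinfun_apply T x) y = cinner x (S y)" for x y
  proof (rule complex_eqI)
    show "Re (cinner (blinfun_apply T x) y) = Re (cinner x (S y))"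
      by (simp add: Re_cinner S)
    show "Im (cinner (blinfun_apply T x) y) = Im (cinner x (S y))"
      using T unfolding Im bounded_operators_def by (simp add: Re_cinner flip: S)
  qed
  with app have "\<forall>x y. cinner (blinfun_apply T x) y = cinner x (blinfun_apply (Blinfun S) y)"
    by simp
  moreover have "S1 = S2"
    if "\<forall>x y. cinner (blinfun_apply T x) y = cinner x (blinfun_apply S1 y)"
       "\<forall>x y. cinner (blinfun_apply T x) y = cinner x (blinfun_apply S2 y)" for S1 S2
    by (rule blinfun_eqI, rule cinner_eqI) (metis that)
  ultimately show ?thesis by blast
qed

lemma cinner_adjoint_operator:
  assumes "T \<in> bounded_operators"
  shows "cinner (blinfun_apply T x) y = cinner x (blinfun_apply (adjoint_operator T) y)"
  using theI'[OF adjoint_operator_ex1[OF assms]] unfolding adjoint_operator_def by blast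

lemma adjoint_operator_in_bounded_operators:
  assumes "T \<in> bounded_operators"
  shows "adjoint_operator T \<in> bounded_operators"
proof -
  have "blinfun_apply (adjoint_operator T) (c *\<^sub>C y) = c *\<^sub>C blinfun_apply (adjoint_operator T) y"
    for c y
    by (rule cinner_eqI)
       (metis cinner_adjoint_operator[OF assms] cinner_commute cinner_scaleC_left)
  then show ?thesis by (simp add: bounded_operators_def)
qed

text \<open>The order on \<open>B(H)\<close>: \<open>S \<le> T\<close> iff \<open>T - S\<close> is a positive operator.\<close>

definition operator_le ::
  "('a::complex_hilbert_space \<Rightarrow>\<^sub>L 'a) \<Rightarrow> ('a \<Rightarrow>\<^sub>L 'a) \<Rightarrow> bool" where
  "operator_le S T \<longleftrightarrow> (\<forall>x. cinner (blinfun_apply (T - S) x) x \<in> \<real>\<^sub>\<ge>\<^sub>0)"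

section \<open>Cuntz families\<close>

definition isometry_operator :: "('a::complex_hilbert_space \<Rightarrow>\<^sub>L 'a) \<Rightarrow> bool" where
  "isometry_operator V \<longleftrightarrow>
     V \<in> bounded_operators \<and> adjoint_operator V o\<^sub>L V = id_blinfun"

definition range_projection ::
  "('a::complex_hilbert_space \<Rightarrow>\<^sub>L 'a) \<Rightarrow> ('a \<Rightarrow>\<^sub>L 'a)" where
  "range_projection V = V o\<^sub>L adjoint_operator V"

text \<open>Families are indexed from \<open>0\<close>.\<close>

definition cuntz_family :: "(nat \<Rightarrow> 'a::complex_hilbert_space \<Rightarrow>\<^sub>L 'a) \<Rightarrow> bool" where
  "cuntz_family v \<longleftrightarrow>
     (\<forall>i. isometry_operator (v i)) \<and>
     (\<forall>n\<ge>1. operator_le (\<Sum>i<n. range_projection (v i)) id_blinfun)"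

definition separates_points :: "(nat \<Rightarrow> 'a::complex_hilbert_space \<Rightarrow>\<^sub>L 'a) \<Rightarrow> bool" where
  "separates_points v \<longleftrightarrow>
     (\<forall>X\<in>bounded_operators.
        (\<forall>i j. range_projection (v i) o\<^sub>L X o\<^sub>L range_projection (v j) = 0) \<longrightarrow> X = 0)"

section \<open>The Cuntz algebra and its representations\<close>

definition unital_cstar_subalgebra :: "('a::complex_hilbert_space \<Rightarrow>\<^sub>L 'a) set \<Rightarrow> bool" where
  "unital_cstar_subalgebra A \<longleftrightarrow>
     A \<subseteq> bounded_operators \<and> closed A \<and> id_blinfun \<in> A \<and>
     (\<forall>S\<in>A. \<forall>T\<in>A. S + T \<in> A \<and> S o\<^sub>L T \<in> A) \<and>
     (\<forall>c. \<forall>T\<in>A. scale_operator c T \<in> A) \<and>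
     (\<forall>T\<in>A. adjoint_operator T \<in> A)"

text \<open>
  For a Cuntz family \<open>v\<close> in \<open>B(H)\<close>, the following unital C*-subalgebra of \<open>B(H)\<close> generated by
  \<open>v\<close> is the copy of the Cuntz algebra \<open>O\<^sub>\<infinity>\<close> determined by \<open>v\<close>.
\<close>

definition cuntz_algebra ::
  "(nat \<Rightarrow> 'a::complex_hilbert_space \<Rightarrow>\<^sub>L 'a) \<Rightarrow> ('a \<Rightarrow>\<^sub>L 'a) set" where
  "cuntz_algebra v = \<Inter>{A. unital_cstar_subalgebra A \<and> range v \<subseteq> A}"

definition unital_representation ::
  "('a::complex_hilbert_space \<Rightarrow>\<^sub>L 'a) set \<Rightarrow>
   (('a \<Rightarrow>\<^sub>L 'a) \<Rightarrow> ('b::complex_hilbert_space \<Rightarrow>\<^sub>L 'b)) \<Rightarrow> bool" where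
  "unital_representation A \<pi> \<longleftrightarrow>
     \<pi> ` A \<subseteq> bounded_operators \<and> \<pi> id_blinfun = id_blinfun \<and>
     (\<forall>S\<in>A. \<forall>T\<in>A. \<pi> (S + T) = \<pi> S + \<pi> T \<and> \<pi> (S o\<^sub>L T) = \<pi> S o\<^sub>L \<pi> T) \<and>
     (\<forall>c. \<forall>T\<in>A. \<pi> (scale_operator c T) = scale_operator c (\<pi> T)) \<and>
     (\<forall>T\<in>A. \<pi> (adjoint_operator T) = adjoint_operator (\<pi> T))"

definition essential_representation ::
  "(nat \<Rightarrow> 'a::complex_hilbert_space \<Rightarrow>\<^sub>L 'a) \<Rightarrow>
   (('a \<Rightarrow>\<^sub>L 'a) \<Rightarrow> ('b::complex_hilbert_space \<Rightarrow>\<^sub>L 'b)) \<Rightarrow> bool" where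
  "essential_representation v \<pi> \<longleftrightarrow>
     unital_representation (cuntz_algebra v) \<pi> \<and>
     limitin strong_operator_topology
       (\<lambda>n. \<Sum>i<n. range_projection (\<pi> (v i))) id_blinfun sequentially"

end

theory Submission
  imports Defs
begin

text \<open>
  The range projections \<open>p\<^sub>i\<close> are mutually orthogonal, so \<open>\<Sum>p\<^sub>i x\<close> converges for every \<open>x\<close>, and
  \<open>y = x - \<Sum>p\<^sub>i x\<close> is annihilated by every \<open>p\<^sub>i\<close>. The operator \<open>z \<mapsto> \<langle>z, y\<rangle> y\<close>
  then satisfies \<open>p\<^sub>i X p\<^sub>j = 0\<close>, so \<open>y = 0\<close> if the family separates points. Conversely, if
  \<open>\<Sum>p\<^sub>i = 1\<close> strongly, then \<open>p\<^sub>i X p\<^sub>j = 0\<close> can be summed first over \<open>j\<close> and then over \<open>i\<close>.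
\<close>

text \<open>Conjugate symmetry makes \<open>cinner x x\<close> real, hence equal to the squared
  norm, and turns linearity in the first argument into conjugate linearity in the second.\<close>

lemma norm_scaleC: "norm (c *\<^sub>C x) = cmod c * norm (x::'a::complex_hilbert_space)"
proof -
  have "cinner x x \<in> \<real>"
    using cinner_commute[of x x] by (metis complex_is_Real_iff cnj.simps(2) neg_equal_zero)
  then have x: "cinner x x = complex_of_real ((norm x)\<^sup>2)"
    by (simp add: complex_eq_iff Re_cinner power2_norm_eq_inner complex_is_Real_iff)
  have "cinner (c *\<^sub>C x) (c *\<^sub>C x) = c * cnj (c * cinner x x)"
    by (metis cinner_commute cinner_scaleC_left)
  also have "\<dots> = complex_of_real ((cmod c * norm x)\<^sup>2)"
    by (simp add: x power_mult_distrib complex_norm_square[symmetric] mult.assoc[symmetric]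
        flip: of_real_power)
  finally have "(norm (c *\<^sub>C x))\<^sup>2 = (cmod c * norm x)\<^sup>2"
    by (metis Re_cinner Re_complex_of_real power2_norm_eq_inner)
  then show ?thesis
    by simp
qed

lemma bounded_linear_scaleC: "bounded_linear (\<lambda>x::'a::complex_hilbert_space. c *\<^sub>C x)"
proof (rule bounded_linear_intro)
  show "c *\<^sub>C (r *\<^sub>R x) = r *\<^sub>R (c *\<^sub>C x)" for r and x :: 'a
    by (simp add: scaleC_scaleC mult.commute flip: scaleC_of_real)
  show "norm (c *\<^sub>C x) \<le> norm x * cmod c" for x :: 'a
    by (simp add: norm_scaleC mult.commute)
qed (rule scaleC_add_right)

lemmas bounded_linear_scaleC_compose = bounded_linear_compose[OF bounded_linear_scaleC]

text \<open>The imaginary part comes from rotating the first argument by \<open>\<i>\<close>. This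
  reduces boundedness of complex inner products to the real case.\<close>

lemma cinner_eq_inner:
  "cinner x y = complex_of_real (inner x y) - \<i> * complex_of_real (inner (\<i> *\<^sub>C x) y)"
  by (simp add: complex_eq_iff cinner_scaleC_left flip: Re_cinner)

lemma bounded_linear_rank_one:
  "bounded_linear (\<lambda>x. cinner x y *\<^sub>C (z::'a::complex_hilbert_space))"
proof -
  have "(\<lambda>x. cinner x y *\<^sub>C z)
      = (\<lambda>x. inner x y *\<^sub>R z - inner (\<i> *\<^sub>C x) y *\<^sub>R (\<i> *\<^sub>C z))"
    by (subst cinner_eq_inner)
       (simp add: complex_space.scale_left_diff_distrib scaleC_scaleC mult.commute
        flip: scaleC_of_real)
  moreover have "bounded_linear \<dots>"
    by (intro bounded_linear_intros bounded_linear_scaleC)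
  ultimately show ?thesis
    by simp
qed

lemma scale_operator_apply: "blinfun_apply (scale_operator c T) x = c *\<^sub>C blinfun_apply T x"
  unfolding scale_operator_def
  by (subst bounded_linear_Blinfun_apply)
     (auto intro!: bounded_linear_scaleC_compose blinfun.bounded_linear_right)

text \<open>This makes B(H) one of the algebras intersected in \<open>cuntz_algebra\<close>, so the
  generated algebra consists of complex-linear operators.\<close>

lemma unital_cstar_subalgebra_bounded_operators: "unital_cstar_subalgebra bounded_operators"
proof -
  have "closed {T::'a::complex_hilbert_space \<Rightarrow>\<^sub>L 'a. blinfun_apply T (c *\<^sub>C x) = c *\<^sub>C blinfun_apply T x}" for c x
    by (intro closed_Collect_eq continuous_intros linear_continuous_on
        bounded_linear_scaleC_compose blinfun.bounded_linear_left)
  then have "closed (bounded_operators :: ('a \<Rightarrow>\<^sub>L 'a) set)"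
    unfolding bounded_operators_def by (intro closed_Collect_all)
  moreover have "adjoint_operator T \<in> bounded_operators" if "T \<in> bounded_operators"
    for T :: "'a \<Rightarrow>\<^sub>L 'a"
    using that by (rule adjoint_operator_in_bounded_operators)
  ultimately show ?thesis
    unfolding unital_cstar_subalgebra_def
    by (auto simp: bounded_operators_def blinfun.add_left scaleC_add_right scale_operator_apply
        scaleC_scaleC mult.commute)
qed

lemma unital_representation_inclusion:
  assumes "cuntz_family v"
  shows "unital_representation (cuntz_algebra v) (\<lambda>T. T)"
proof -
  have "range v \<subseteq> bounded_operators"
    using assms by (auto simp: cuntz_family_def isometry_operator_def)
  then have "cuntz_algebra v \<subseteq> bounded_operators"
    using unital_cstar_subalgebra_bounded_operators unfolding cuntz_algebra_def by blast
  then show ?thesis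
    by (simp add: unital_representation_def)
qed

text \<open>The strong operator topology is pulled back along \<open>blinfun_apply\<close> from the
  product topology on functions, where convergence is componentwise.\<close>

lemma limitin_strong_operator_topology:
  "limitin strong_operator_topology T L F \<longleftrightarrow>
     (\<forall>x. ((\<lambda>n. blinfun_apply (T n) x) \<longlongrightarrow> blinfun_apply L x) F)"
proof -
  have "limitin strong_operator_topology T L F \<longleftrightarrow>
      ((\<lambda>n. blinfun_apply (T n)) \<longlongrightarrow> blinfun_apply L) F"
    unfolding strong_operator_topology_def limitin_def tendsto_def
    by (auto simp: openin_pullback_topology topspace_pullback_topology)
  also have "\<dots> \<longleftrightarrow> (\<forall>x. ((\<lambda>n. blinfun_apply (T n) x) \<longlongrightarrow> blinfun_apply L x) F)"
    using limitin_componentwise[of "\<lambda>_. euclidean" UNIV "\<lambda>n. blinfun_apply (T n)" "blinfun_apply L" F]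
    by (simp add: euclidean_product_topology)
  finally show ?thesis .
qed

lemma inner_adjoint_operator:
  assumes "T \<in> bounded_operators"
  shows "inner (blinfun_apply T x) y = inner x (blinfun_apply (adjoint_operator T) y)"
  using cinner_adjoint_operator[OF assms, of x y] by (simp flip: Re_cinner)

lemma adjoint_isometry_apply:
  assumes "isometry_operator V"
  shows "blinfun_apply (adjoint_operator V) (blinfun_apply V x) = x"
  using assms unfolding isometry_operator_def
  by (metis blinfun_apply_blinfun_compose blinfun_apply_id_blinfun id_apply)

lemma range_projection_idem:
  assumes "isometry_operator V"
  shows "blinfun_apply (range_projection V) (blinfun_apply (range_projection V) x)
       = blinfun_apply (range_projection V) x"
  by (simp add: range_projection_def adjoint_isometry_apply[OF assms])

lemma inner_range_projection:
  assumes "isometry_operator V"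
  shows "inner (blinfun_apply (range_projection V) x) y
       = inner x (blinfun_apply (range_projection V) y)"
proof -
  have "V \<in> bounded_operators"
    using assms by (simp add: isometry_operator_def)
  from inner_adjoint_operator[OF this] show ?thesis
    by (simp add: range_projection_def) (metis inner_commute)
qed

lemma inner_range_projection_self:
  assumes "isometry_operator V"
  shows "inner (blinfun_apply (range_projection V) x) x
       = (norm (blinfun_apply (range_projection V) x))\<^sup>2"
  by (metis assms inner_commute inner_range_projection power2_norm_eq_inner range_projection_idem)

context
  fixes v :: "nat \<Rightarrow> 'h::complex_hilbert_space \<Rightarrow>\<^sub>L 'h"
  assumes cuntz: "cuntz_family v"
begin

private abbreviation "p i \<equiv> blinfun_apply (range_projection (v i))"

lemma isometry_cuntz: "isometry_operator (v i)"
  using cuntz by (simp add: cuntz_family_def)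

text \<open>Pair the order inequality of the Cuntz family with \<open>x\<close>: each projection
  contributes \<langle>\<open>p i x\<close>, \<open>x\<close>\<rangle>, which is its squared
  norm.\<close>

lemma bessel: "(\<Sum>i<n. (norm (p i x))\<^sup>2) \<le> (norm x)\<^sup>2"
proof (cases "n \<ge> 1")
  case True
  then have "cinner (blinfun_apply (id_blinfun - (\<Sum>i<n. range_projection (v i))) x) x \<in> \<real>\<^sub>\<ge>\<^sub>0"
    using cuntz unfolding cuntz_family_def operator_le_def by blast
  then have "0 \<le> inner (x - (\<Sum>i<n. p i x)) x"
    by (simp add: complex_nonneg_Reals_iff Re_cinner blinfun.diff_left blinfun.sum_left)
  then show ?thesis
    by (simp add: inner_diff_left inner_sum_left inner_range_projection_self[OF isometry_cuntz]
        power2_norm_eq_inner[symmetric])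
qed (simp add: not_le)

text \<open>Apply \<open>bessel\<close> to a vector in the range of \<open>p j\<close>: by
  idempotence the term at \<open>j\<close> already exhausts the bound, leaving nothing for the term
  at \<open>i\<close>.\<close>

lemma range_projection_orthogonal:
  assumes "i \<noteq> j"
  shows "p i (p j x) = 0"
proof -
  let ?u = "p j x"
  \<comment> \<open>The initial segment below \<open>Suc (max i j)\<close> contains both indices;
    its other terms are nonnegative.\<close>
  have "(\<Sum>k\<in>{i, j}. (norm (p k ?u))\<^sup>2) \<le> (\<Sum>k<Suc (max i j). (norm (p k ?u))\<^sup>2)"
    by (rule sum_mono2) auto
  also have "\<dots> \<le> (norm ?u)\<^sup>2"
    by (rule bessel)
  finally show ?thesis
    using assms by (simp add: range_projection_idem[OF isometry_cuntz])
qed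

text \<open>By Pythagoras a block of the series has squared norm equal to the same block of the
  series of squared norms, which converges by \<open>bessel\<close>.\<close>

lemma summable_range_projection: "summable (\<lambda>i. p i x)"
  unfolding summable_Cauchy
proof (intro allI impI)
  fix e :: real
  assume "0 < e"
  have "summable (\<lambda>i. (norm (p i x))\<^sup>2)"
    by (rule summableI_nonneg_bounded[where x = "(norm x)\<^sup>2"]) (simp_all add: bessel)
  then obtain N where N: "\<And>m n. m \<ge> N \<Longrightarrow> norm (\<Sum>i=m..<n. (norm (p i x))\<^sup>2) < e\<^sup>2"
    using \<open>0 < e\<close> unfolding summable_Cauchy by (metis zero_less_power)
  have "norm (\<Sum>i=m..<n. p i x) < e" if "m \<ge> N" for m n
  proof -
    have "(norm (\<Sum>i=m..<n. p i x))\<^sup>2 = (\<Sum>i=m..<n. (norm (p i x))\<^sup>2)"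
      by (rule norm_sum_Pythagorean)
         (auto simp: pairwise_def orthogonal_def inner_range_projection[OF isometry_cuntz]
           range_projection_orthogonal)
    also have "\<dots> < e\<^sup>2"
      using N[OF that, of n] by simp
    finally show ?thesis
      using \<open>0 < e\<close> by (simp add: power_less_imp_less_base)
  qed
  then show "\<exists>N. \<forall>m\<ge>N. \<forall>n. norm (\<Sum>i=m..<n. p i x) < e"
    by blast
qed

text \<open>Continuity moves \<open>p i\<close> inside the series, and orthogonality leaves only the
  term \<open>k = i\<close>.\<close>

lemma range_projection_suminf: "p i (\<Sum>k. p k x) = p i x"
proof -
  have "(\<lambda>k. p i (p k x)) sums p i (\<Sum>k. p k x)"
    by (intro bounded_linear.sums[OF blinfun.bounded_linear_right] summable_sums summable_range_projection)
  moreover have "(\<lambda>k. p i (p k x)) = (\<lambda>k. if k = i then p i x else 0)"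
    by (auto simp: range_projection_orthogonal range_projection_idem[OF isometry_cuntz])
  ultimately show ?thesis
    using sums_single[of i "\<lambda>_. p i x"] sums_unique2 by metis
qed

lemma suminf_range_projection_if_separates:
  assumes "separates_points v"
  shows "(\<Sum>k. p k x) = x"
proof -
  define y where "y = x - (\<Sum>k. p k x)"
  define X where "X = Blinfun (\<lambda>z. cinner z y *\<^sub>C y)"
  have X: "blinfun_apply X z = cinner z y *\<^sub>C y" for z
    unfolding X_def by (simp add: bounded_linear_Blinfun_apply bounded_linear_rank_one)
  \<comment> \<open>Every value of \<open>X\<close> is a complex multiple of \<open>y\<close>, so
    this already gives \<open>p i\<close> after \<open>X\<close> equal to zero. Complex linearity of
    \<open>p i\<close> has to be checked, since the operator type only provides real
    linearity.\<close>
  have p: "p i (c *\<^sub>C y) = 0" for i c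
  proof -
    have "range_projection (v i) \<in> bounded_operators"
      using isometry_cuntz[of i] adjoint_operator_in_bounded_operators[of "v i"]
      by (auto simp: isometry_operator_def range_projection_def bounded_operators_def)
    then have "p i (c *\<^sub>C y) = c *\<^sub>C p i y"
      by (simp add: bounded_operators_def)
    then show ?thesis
      by (simp add: y_def blinfun.diff_right range_projection_suminf)
  qed
  have "X \<in> bounded_operators"
    by (simp add: bounded_operators_def X cinner_scaleC_left scaleC_scaleC)
  moreover have "range_projection (v i) o\<^sub>L X o\<^sub>L range_projection (v j) = 0" for i j
    by (rule blinfun_eqI) (simp add: X p)
  ultimately have "X = 0"
    using assms by (auto simp: separates_points_def)
  \<comment> \<open>Evaluating \<open>X\<close> at \<open>y\<close> itself gives the squared norm of
    \<open>y\<close> times \<open>y\<close>.\<close>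
  then have "cinner y y *\<^sub>C y = 0"
    using X[of y] by simp
  then have "y = 0"
    by (metis Re_cinner complex_space.scale_eq_0_iff inner_eq_zero_iff zero_complex.simps(1))
  then show ?thesis
    by (simp add: y_def)
qed

end

lemma separates_points_if_range_projections_sum:
  assumes sums: "\<And>x. (\<lambda>i. blinfun_apply (range_projection (v i)) x) sums x"
  shows "separates_points v"
  unfolding separates_points_def
proof (intro ballI impI)
  fix X :: "'a \<Rightarrow>\<^sub>L 'a"
  assume "\<forall>i j. range_projection (v i) o\<^sub>L X o\<^sub>L range_projection (v j) = 0"
  then have 0: "blinfun_apply (range_projection (v i) o\<^sub>L X)
      (blinfun_apply (range_projection (v j)) x) = 0" for i j x
    by (metis blinfun_apply_blinfun_compose zero_blinfun.rep_eq)
  \<comment> \<open>Summation over \<open>j\<close>: the bounded operator \<open>p\<^sub>i X\<close>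
    is applied termwise to the expansion of \<open>x\<close>.\<close>
  have "blinfun_apply (range_projection (v i) o\<^sub>L X) x = 0" for i x
    using bounded_linear.sums[OF blinfun.bounded_linear_right sums[of x],
        of "range_projection (v i) o\<^sub>L X"]
    unfolding 0 using sums_zero sums_unique2 by metis
  \<comment> \<open>Summation over \<open>i\<close>: all terms in the expansion of
    \<open>X x\<close> vanish.\<close>
  then have "blinfun_apply X x = 0" for x
    using sums[of "blinfun_apply X x"] by (simp add: sums_iff)
  then show "X = 0"
    by (intro blinfun_eqI) simp
qed

theorem theorem15:
  fixes v :: "nat \<Rightarrow> 'h::complex_hilbert_space \<Rightarrow>\<^sub>L 'h"
  assumes "infinite_dimensional TYPE('h)"
    and "cuntz_family v"
  shows "separates_points v \<longleftrightarrow> essential_representation v (\<lambda>T. T)"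
proof -
  \<comment> \<open>The inclusion is always a unital representation, so only strong convergence of
    the partial sums remains, which is pointwise summation.\<close>
  have "essential_representation v (\<lambda>T. T) \<longleftrightarrow>
      (\<forall>x. (\<lambda>i. blinfun_apply (range_projection (v i)) x) sums x)"
    using unital_representation_inclusion[OF assms(2)]
    by (simp add: essential_representation_def limitin_strong_operator_topology sums_def
        blinfun.sum_left)
  moreover have "(\<lambda>i. blinfun_apply (range_projection (v i)) x) sums x"
    if "separates_points v" for x
    using summable_sums[OF summable_range_projection[OF assms(2)], of x]
    by (simp add: suminf_range_projection_if_separates[OF assms(2) that])
  ultimately show ?thesis
    using separates_points_if_range_projections_sum by blast
qed

end
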